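(* Let $q,a,b,z$ be complex numbers with $|q|<1$, $|b/a|<|z|<1$ and $|a|<1$. Then \[ \sum_{n=-\infty}^{\infty}\frac{(a)_n}{(b)_n}z^n = -1 +\frac{(a)_\infty(qz)_\infty}{(b)_\infty(z)_\infty}\sum_{n=0}^{\infty}\frac{(b/a)_n(z)_n}{(q)_n(qz)_n}a^n +\frac{(b/a)_\infty(q/az)_\infty}{(q/a)_\infty(b/az)_\infty}\sum_{n=0}^{\infty}\frac{(q/z)_n(q/b)_n}{(q)_n(q/az)_n}(b/a)^n . \]
   Context: For $|q|<1$ and complex $x$, $(x)_\infty=(x;q)_\infty=\prod_{k=0}^{\infty}(1-xq^k)$, and for any integer $n$ (positive, zero or negative), $(x)_n=(x)_\infty/(xq^n)_\infty$. *)

theory Defs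
  imports "HOL-Analysis.Analysis"
begin

definition qpoch_inf :: "complex \<Rightarrow> complex \<Rightarrow> complex" where
  "qpoch_inf q x = (\<Prod>k. 1 - x * q ^ k)"

text \<open>
  The first branch is the quotient $(x)_\infty/(xq^n)_\infty$. The other two only apply when its
  denominator vanishes; they give the value of the quotient after cancelling the common factors.
  (For instance $(q^{-1})_1 = 1 - q^{-1}$, although the quotient reads $0/0$.)
  If $n < 0$ and $x = q^k$ with $1 \le k \le -n$, then $(x)_n$ is a genuine pole, and the
  totalised division returns $0$. A term having such an $(x)_n$ as its denominator is then $0$,
  in accordance with $1/(x)_n = (xq^n)_\infty/(x)_\infty = 0$.
\<close>
definition qpoch :: "complex \<Rightarrow> complex \<Rightarrow> int \<Rightarrow> complex" where
  "qpoch q x n =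
    (if qpoch_inf q (x * q powi n) \<noteq> 0 then qpoch_inf q x / qpoch_inf q (x * q powi n)
     else if n \<ge> 0 then (\<Prod>k<nat n. 1 - x * q ^ k)
     else 1 / (\<Prod>k=1..nat (-n). 1 - x / q ^ k))"

lemma convergent_prod_qpoch_inf:
  assumes "norm q < 1"
  shows "convergent_prod (\<lambda>k. 1 - x * q ^ k :: complex)"
proof -
  have "summable (\<lambda>k. norm ((1 - x * q ^ k) - 1))"
    using assms by (simp add: norm_mult norm_power summable_mult summable_geometric)
  then show ?thesis
    by (intro abs_convergent_prod_imp_convergent_prod summable_imp_abs_convergent_prod)
qed

lemma qpoch_inf_split:
  assumes "norm q < 1"
  shows "qpoch_inf q x = (\<Prod>k<n. 1 - x * q ^ k) * qpoch_inf q (x * q ^ n)"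
proof (induction n)
  case (Suc n)
  have "qpoch_inf q y = (1 - y) * qpoch_inf q (y * q)" for y
  proof -
    from has_prod_ignore_initial_segment'[OF convergent_prod_qpoch_inf[OF assms], of y 1]
    have *: "(\<lambda>k. 1 - y * q ^ k) has_prod ((1 - y) * (\<Prod>k. 1 - y * q ^ Suc k))"
      by simp
    have "(\<Prod>k. 1 - y * q ^ Suc k) = qpoch_inf q (y * q)"
      unfolding qpoch_inf_def by (simp add: mult.assoc)
    with * show ?thesis
      unfolding qpoch_inf_def using has_prod_unique2 has_prod_iff by metis
  qed
  from this[of "x * q ^ n"] Suc show ?case
    by (simp add: mult_ac)
qed simp

lemma qpoch_nonneg:
  assumes "norm q < 1"
  shows "qpoch q x (int n) = (\<Prod>k<n. 1 - x * q ^ k)"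
  using qpoch_inf_split[OF assms, of x n] by (simp add: qpoch_def)

lemma qpoch_neg:
  assumes "norm q < 1" "q \<noteq> 0"
  shows "qpoch q x (- int n) = 1 / (\<Prod>k=1..n. 1 - x / q ^ k)"
proof (cases "n = 0")
  case True
  then show ?thesis
    using qpoch_nonneg[OF assms(1), of x 0] by simp
next
  case False
  let ?y = "x / q ^ n"
  have "(\<Prod>k<n. 1 - ?y * q ^ k) = (\<Prod>k=1..n. 1 - x / q ^ k)"
    by (rule prod.reindex_bij_witness[of _ "\<lambda>k. n - k" "\<lambda>k. n - k"])
       (use assms in \<open>auto simp: power_diff field_simps\<close>)
  with qpoch_inf_split[OF assms(1), of ?y n] assms(2)
  have *: "qpoch_inf q ?y = (\<Prod>k=1..n. 1 - x / q ^ k) * qpoch_inf q x"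
    by simp
  have "x * q powi (- int n) = ?y"
    by (simp add: power_int_minus field_simps)
  with * False show ?thesis
    by (auto simp: qpoch_def)
qed

end

theory Submission
  imports Defs
begin

text \<open>
  Split the bilateral series at \<open>n = 0\<close>. With \<open>d = b/a\<close>, the terms with \<open>n \<ge> 0\<close> are, up to the
  factor \<open>(a)\<^sub>\<infinity>/(b)\<^sub>\<infinity>\<close>, equal to \<open>(daq\<^sup>n)\<^sub>\<infinity>/(aq\<^sup>n)\<^sub>\<infinity> z\<^sup>n\<close>. The \<open>q\<close>-binomial theorem shows
  that \<open>R(x) = \<Sum> (d)\<^sub>k/(q)\<^sub>k x\<^sup>k/(1 - zq\<^sup>k)\<close> satisfies \<open>R(x) - z R(xq) = (dx)\<^sub>\<infinity>/(x)\<^sub>\<infinity>\<close>, so the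
  series telescopes to \<open>R(a)\<close>.

  With \<open>B = q/b\<close> and \<open>Z = b/(az)\<close>, the terms with \<open>n \<le> 0\<close> are, up to the factor \<open>1/(dB)\<^sub>\<infinity>\<close>, equal
  to \<open>(B)\<^sub>n (dBq\<^sup>n)\<^sub>\<infinity> Z\<^sup>n\<close>. The \<open>q\<close>-Gauss sum shows that
  \<open>H(B) = (d)\<^sub>\<infinity>/(Z)\<^sub>\<infinity> \<Sum> (qZ/d)\<^sub>k (B)\<^sub>k (BZq\<^sup>k)\<^sub>\<infinity>/(q)\<^sub>k d\<^sup>k\<close> satisfies
  \<open>H(B) - (1 - B) Z H(Bq) = (dB)\<^sub>\<infinity>\<close>, so this series telescopes to \<open>H(B)\<close>. Heine's transformation
  would need \<open>|B| < 1\<close> and an analytic continuation; telescoping works for every \<open>B\<close>.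

  The \<open>q\<close>-Gauss sum \<open>S(A,B) = (dA)\<^sub>\<infinity> (dB)\<^sub>\<infinity>/(d)\<^sub>\<infinity>\<close> itself follows from \<open>S(A,B) = (1 - dB) S(A,Bq)\<close>
  and the symmetry in \<open>A\<close> and \<open>B\<close>, which give \<open>S(A,B) = (dA)\<^sub>\<infinity> (dB)\<^sub>\<infinity> S(0,0)\<close>; the trivial case
  \<open>A = 1\<close>, \<open>B = 0\<close> determines \<open>S(0,0)\<close>.
\<close>

section \<open>Finite q-shifted factorials and uniform bounds\<close>

definition qfac :: "complex \<Rightarrow> complex \<Rightarrow> nat \<Rightarrow> complex" where
  "qfac q x n = (\<Prod>k<n. 1 - x * q ^ k)"

lemma qfac_0 [simp]: "qfac q x 0 = 1"
  by (simp add: qfac_def)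

lemma qfac_Suc: "qfac q x (Suc n) = qfac q x n * (1 - x * q ^ n)"
  by (simp add: qfac_def)

lemma qfac_Suc_shift: "qfac q x (Suc n) = (1 - x) * qfac q (x * q) n"
  unfolding qfac_def prod.lessThan_Suc_shift by (simp add: mult.assoc)

lemma qfac_zero [simp]: "qfac q 0 n = 1"
  by (simp add: qfac_def)

lemma qfac_one_Suc [simp]: "qfac q 1 (Suc n) = 0"
  by (simp add: qfac_Suc_shift)

lemma qfac_nonzero: "(\<And>k. x * q ^ k \<noteq> 1) \<Longrightarrow> qfac q x n \<noteq> 0"
  by (auto simp: qfac_def)

lemma norm_geometric_less_1:
  fixes q x :: complex
  assumes "norm q < 1" "norm x < 1"
  shows "norm (x * q ^ k) < 1"
proof -
  have "norm (x * q ^ k) \<le> norm x * 1"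
    unfolding norm_mult norm_power using assms by (intro mult_left_mono power_le_one) auto
  with assms show ?thesis by simp
qed

lemma geometric_neq_1:
  fixes q x :: complex
  assumes "norm q < 1" "norm x < 1"
  shows "x * q ^ k \<noteq> 1"
  using norm_geometric_less_1[OF assms, of k] by auto

lemma norm_geometric_le:
  fixes q x :: complex
  assumes "norm q < 1"
  shows "norm (x * q ^ k) \<le> norm x"
  unfolding norm_mult norm_power using assms by (intro mult_left_le power_le_one) auto

text \<open>Putting norms inside the product bounds its distance from 1, and the exponential of a
  geometric sum bounds the result. The bound does not depend on \<open>n\<close>, so it passes to
  the infinite product, and it tends to 0 with \<open>x\<close>.\<close>

lemma norm_qfac_minus_1_le:
  assumes "norm q < 1"
  shows "norm (qfac q x n - 1) \<le> exp (norm x / (1 - norm q)) - 1"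
proof -
  have "norm (qfac q x n - 1) \<le> (\<Prod>k<n. 1 + norm (- (x * q ^ k))) - 1"
    using norm_prod_minus1_le_prod_minus1[of "\<lambda>k. - (x * q ^ k)" "{..<n}"]
    by (simp add: qfac_def)
  also have "\<dots> \<le> exp (\<Sum>k<n. norm (- (x * q ^ k))) - 1"
    by (intro diff_right_mono prod_le_exp_sum) auto
  also have "(\<Sum>k<n. norm (- (x * q ^ k))) = norm x * (\<Sum>k<n. norm q ^ k)"
    by (simp add: norm_mult norm_power sum_distrib_left)
  also have "exp (norm x * (\<Sum>k<n. norm q ^ k)) - 1 \<le> exp (norm x * (1 / (1 - norm q))) - 1"
  proof -
    have "(\<Sum>k<n. norm q ^ k) \<le> (\<Sum>k. norm q ^ k)"
      using assms by (intro sum_le_suminf summable_geometric) auto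
    also have "\<dots> = 1 / (1 - norm q)"
      using assms by (simp add: suminf_geometric)
    finally show ?thesis
      by (intro diff_right_mono) (simp only: exp_le_cancel_iff mult_left_mono norm_ge_zero)
  qed
  finally show ?thesis by simp
qed

lemma summable_norm_Bseq_times_power:
  fixes c :: "nat \<Rightarrow> complex"
  assumes "Bseq c" "norm x < 1"
  shows "summable (\<lambda>n. norm (c n * x ^ n))"
proof -
  obtain K where K: "\<And>n. norm (c n) \<le> K"
    using assms(1) by (metis BseqE)
  show ?thesis
    by (rule summable_comparison_test'[where g = "\<lambda>n. K * norm x ^ n"])
       (use assms(2) K in \<open>auto simp: norm_mult norm_power intro: mult_right_mono\<close>)
qed

lemma Bseq_times_power_tendsto_0:
  fixes c :: "nat \<Rightarrow> complex"
  assumes "Bseq c" "norm x < 1"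
  shows "(\<lambda>n. c n * x ^ n) \<longlonglongrightarrow> 0"
  by (rule summable_LIMSEQ_zero[OF summable_norm_cancel[OF summable_norm_Bseq_times_power[OF assms]]])

context
  fixes q :: complex
  assumes q: "norm q < 1"
begin

section \<open>Infinite products as limits of finite ones\<close>

lemma qfac_tendsto: "qfac q x \<longlonglongrightarrow> qpoch_inf q x"
  using has_prod_imp_tendsto'[OF convergent_prod_has_prod[OF convergent_prod_qpoch_inf[OF q]]]
  by (simp add: qfac_def[abs_def] qpoch_inf_def)

lemma qpoch_inf_eq_qfac: "qpoch_inf q x = qfac q x n * qpoch_inf q (x * q ^ n)"
  using qpoch_inf_split[OF q] by (simp add: qfac_def)

lemma qpoch_inf_step: "qpoch_inf q x = (1 - x) * qpoch_inf q (x * q)"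
  using qpoch_inf_eq_qfac[of x 1] by (simp add: qfac_Suc)

lemma qpoch_inf_nonzero: "(\<And>k. x * q ^ k \<noteq> 1) \<Longrightarrow> qpoch_inf q x \<noteq> 0"
  unfolding qpoch_inf_def by (intro prodinf_nonzero convergent_prod_qpoch_inf q) auto

lemma qpoch_inf_zero [simp]: "qpoch_inf q 0 = 1"
  by (simp add: qpoch_inf_def)

lemma norm_qpoch_inf_minus_1_le: "norm (qpoch_inf q x - 1) \<le> exp (norm x / (1 - norm q)) - 1"
  by (rule tendsto_upperbound[OF tendsto_norm[OF tendsto_diff[OF qfac_tendsto tendsto_const]]])
     (auto intro!: always_eventually norm_qfac_minus_1_le q)

lemma norm_qfac_le: "norm x \<le> r \<Longrightarrow> norm (qfac q x n) \<le> exp (r / (1 - norm q))"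
proof -
  assume "norm x \<le> r"
  then have "exp (norm x / (1 - norm q)) \<le> exp (r / (1 - norm q))"
    using q by (simp add: divide_right_mono)
  then show ?thesis
    using norm_qfac_minus_1_le[OF q, of x n] norm_triangle_sub[of "qfac q x n" 1]
    unfolding norm_one by linarith
qed

lemma norm_qpoch_inf_le: "norm x \<le> r \<Longrightarrow> norm (qpoch_inf q x) \<le> exp (r / (1 - norm q))"
  by (rule tendsto_upperbound[OF tendsto_norm[OF qfac_tendsto]]) (auto intro!: always_eventually norm_qfac_le)

lemma qpoch_inf_tendsto_1:
  assumes "(f \<longlongrightarrow> 0) F"
  shows "((\<lambda>m. qpoch_inf q (f m)) \<longlongrightarrow> 1) F"
proof -
  have "((\<lambda>m. exp (norm (f m) / (1 - norm q)) - 1) \<longlongrightarrow> 0) F"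
    using q by (auto intro!: tendsto_eq_intros assms)
  then have "((\<lambda>m. qpoch_inf q (f m) - 1) \<longlongrightarrow> 0) F"
    by (rule Lim_null_comparison[OF always_eventually[OF allI[OF norm_qpoch_inf_minus_1_le]]])
  then show ?thesis
    by (simp add: LIM_zero_iff)
qed

lemma qfac_q_nonzero [simp]: "qfac q q n \<noteq> 0"
  by (intro qfac_nonzero geometric_neq_1 q)

lemma Bseq_qfac: "Bseq (qfac q x)"
  by (rule BseqI'[of _ "exp (norm x / (1 - norm q))"]) (rule norm_qfac_le, simp)

text \<open>The limit \<open>qpoch_inf q x\<close> is nonzero, so the reciprocals converge as
  well.\<close>

lemma Bseq_inverse_qfac:
  assumes "\<And>k. x * q ^ k \<noteq> 1"
  shows "Bseq (\<lambda>n. 1 / qfac q x n)"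
  using tendsto_divide[OF tendsto_const[of 1] qfac_tendsto qpoch_inf_nonzero[OF assms]]
  by (auto intro!: convergent_imp_Bseq simp: convergent_def)

lemma Bseq_qfac_quotient:
  assumes "\<And>k. y * q ^ k \<noteq> 1"
  shows "Bseq (\<lambda>n. qfac q x n / qfac q y n)"
  using Bseq_mult[OF Bseq_qfac Bseq_inverse_qfac[OF assms]] by simp

lemma geometric_tendsto_0: "(\<lambda>m. x * q ^ m) \<longlonglongrightarrow> 0"
  using tendsto_mult[OF tendsto_const LIMSEQ_power_zero[OF q], of x] by simp

section \<open>The q-Gauss sum\<close>

text \<open>
  For \<open>X = ABd\<close> this is the term of the \<open>q\<close>-Gauss series times \<open>(ABd)\<^sub>\<infinity>\<close>. Absorbing that factor
  removes all denominators that depend on \<open>B\<close>.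
\<close>
definition gauss_term :: "complex \<Rightarrow> complex \<Rightarrow> complex \<Rightarrow> complex \<Rightarrow> nat \<Rightarrow> complex" where
  "gauss_term d A B X n = qfac q A n * qfac q B n * qpoch_inf q (X * q ^ n) / qfac q q n * d ^ n"

text \<open>\<open>M\<close> is uniform over the balls for \<open>B\<close> and \<open>X\<close>, so
  one geometric series dominates all shifts \<open>B * q ^ m\<close>, \<open>X * q ^ m\<close> at
  once. Summability, boundedness in \<open>m\<close> and the limit by Tannery's theorem all rest on
  it.\<close>

lemma norm_gauss_term_le:
  obtains M where "\<And>B X n. norm B \<le> r \<Longrightarrow> norm X \<le> s \<Longrightarrow> norm (gauss_term d A B X n) \<le> M * norm d ^ n"
proof -
  obtain K where K: "\<And>n. norm (qfac q A n / qfac q q n) \<le> K"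
    using Bseq_qfac_quotient[of q A] geometric_neq_1[OF q q] by (metis BseqE)
  have K0: "K \<ge> 0"
    using K[of 0] by simp
  show ?thesis
  proof (rule that)
    fix B X :: complex and n assume BX: "norm B \<le> r" "norm X \<le> s"
    have "gauss_term d A B X n = (qfac q A n / qfac q q n) * qfac q B n * qpoch_inf q (X * q ^ n) * d ^ n"
      by (simp add: gauss_term_def)
    also have "norm \<dots> = norm (qfac q A n / qfac q q n) * norm (qfac q B n)
        * norm (qpoch_inf q (X * q ^ n)) * norm d ^ n"
      by (simp only: norm_mult norm_power)
    also have "\<dots> \<le> K * exp (r / (1 - norm q)) * exp (s / (1 - norm q)) * norm d ^ n"
    proof -
      have "norm (qfac q B n) \<le> exp (r / (1 - norm q))"
        using BX(1) by (rule norm_qfac_le)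
      moreover have "norm (qpoch_inf q (X * q ^ n)) \<le> exp (s / (1 - norm q))"
        using order_trans[OF norm_geometric_le[OF q] BX(2)] by (rule norm_qpoch_inf_le)
      ultimately show ?thesis
        using K[of n] K0 by (simp add: mult_mono mult_right_mono del: norm_divide)
    qed
    finally show "norm (gauss_term d A B X n) \<le> (K * exp (r / (1 - norm q)) * exp (s / (1 - norm q))) * norm d ^ n" .
  qed
qed

lemma summable_gauss_term:
  assumes "norm d < 1"
  shows "summable (gauss_term d A B X)"
proof -
  obtain M where M: "\<And>B' X' n. norm B' \<le> norm B \<Longrightarrow> norm X' \<le> norm X \<Longrightarrow>
      norm (gauss_term d A B' X' n) \<le> M * norm d ^ n"
    using norm_gauss_term_le[of "norm B" "norm X" d A] by blast
  show ?thesis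
    by (rule summable_comparison_test'[where g = "\<lambda>n. M * norm d ^ n"])
       (use assms M in auto)
qed

lemma Bseq_suminf_gauss_term:
  assumes "norm d < 1"
  shows "Bseq (\<lambda>m. \<Sum>n. gauss_term d A (B * q ^ m) (X * q ^ m) n)"
proof -
  obtain M where M: "\<And>B' X' n. norm B' \<le> norm B \<Longrightarrow> norm X' \<le> norm X \<Longrightarrow>
      norm (gauss_term d A B' X' n) \<le> M * norm d ^ n"
    using norm_gauss_term_le[of "norm B" "norm X" d A] by blast
  show ?thesis
    by (rule BseqI'[where K = "\<Sum>n. M * norm d ^ n"])
       (use assms in \<open>auto intro!: norm_suminf_le M norm_geometric_le q summable_mult summable_geometric\<close>)
qed

lemma suminf_gauss_term_tendsto:
  assumes "norm d < 1"
  shows "(\<lambda>m. \<Sum>n. gauss_term d A (B * q ^ m) (X * q ^ m) n) \<longlonglongrightarrow> (\<Sum>n. gauss_term d A 0 0 n)"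
proof -
  obtain M where M: "\<And>B' X' n. norm B' \<le> norm B \<Longrightarrow> norm X' \<le> norm X \<Longrightarrow>
      norm (gauss_term d A B' X' n) \<le> M * norm d ^ n"
    using norm_gauss_term_le[of "norm B" "norm X" d A] by blast
  have 1: "(\<lambda>m. gauss_term d A (B * q ^ m) (X * q ^ m) n) \<longlonglongrightarrow> gauss_term d A 0 0 n" for n
  proof -
    have "(\<lambda>m. qfac q (B * q ^ m) n) \<longlonglongrightarrow> qfac q 0 n"
      unfolding qfac_def by (intro tendsto_intros geometric_tendsto_0)
    moreover have "(\<lambda>m. qpoch_inf q (X * q ^ m * q ^ n)) \<longlonglongrightarrow> 1"
      using tendsto_mult[OF geometric_tendsto_0[of X] tendsto_const[of "q ^ n"]]
      by (intro qpoch_inf_tendsto_1) simp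
    ultimately show ?thesis
      unfolding gauss_term_def by (auto intro!: tendsto_eq_intros)
  qed
  have 2: "summable (\<lambda>n. M * norm d ^ n)"
    using assms by (intro summable_mult summable_geometric) auto
  have 3: "eventually (\<lambda>(n, m). norm (gauss_term d A (B * q ^ m) (X * q ^ m) n) \<le> M * norm d ^ n)
      (at_top \<times>\<^sub>F sequentially)"
    by (intro always_eventually) (auto intro!: M norm_geometric_le q)
  show ?thesis
    using tannerys_theorem[OF 1 3 2] by simp
qed

text \<open>Replacing \<open>B\<close> by \<open>B * q\<close> turns \<open>A * B * d\<close> into
  \<open>A * B * d * q\<close>, so both series have the q-Gauss shape and the step can be
  iterated.\<close>

lemma gauss_step:
  assumes "norm d < 1"
  shows "(\<Sum>n. gauss_term d A B (A * B * d) n) = (1 - d * B) * (\<Sum>n. gauss_term d A (B * q) (A * B * d * q) n)"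
proof -
  \<comment> \<open>a \<open>q\<close>-Zeilberger certificate: the termwise difference of the two sides is \<open>T (Suc n) - T n\<close>\<close>
  define T where "T n = (case n of 0 \<Rightarrow> 0 | Suc m \<Rightarrow>
    B * d * (1 - A * q ^ m) * gauss_term d A (B * q) (A * B * d * q) m)" for n
  have step: "gauss_term d A B (A * B * d) n - (1 - d * B) * gauss_term d A (B * q) (A * B * d * q) n
     = T (Suc n) - T n" for n
  proof (cases n)
    case 0
    then show ?thesis
      using qpoch_inf_step[of "A * B * d"]
      by (simp add: T_def gauss_term_def algebra_simps)
  next
    case (Suc m)
    \<comment> \<open>\<open>E\<close> collects what the three terms below share; beyond it only
      polynomial factors and the denominator \<open>1 - q * u\<close> remain.\<close>
    define E where "E = qfac q A m * qfac q (B * q) m * qpoch_inf q (A * B * d * q * q ^ Suc m)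
      / qfac q q m * d ^ m"
    define u where "u = q ^ m"
    have nz: "1 - q * u \<noteq> 0"
      using geometric_neq_1[OF q q, of m] by (auto simp: u_def)
    have P: "qpoch_inf q (A * B * d * q * u) = (1 - A * B * d * q * u) * qpoch_inf q (A * B * d * q * q ^ Suc m)"
      using qpoch_inf_step[of "A * B * d * q * u"] by (simp add: u_def mult_ac)
    have P': "qpoch_inf q (A * B * d * q ^ Suc m) = (1 - A * B * d * q * u) * qpoch_inf q (A * B * d * q * q ^ Suc m)"
      using P by (simp add: u_def mult_ac)
    have g1: "gauss_term d A B (A * B * d) n = E * d * (1 - A * u) / (1 - q * u) * (1 - B) * (1 - A * B * d * q * u)"
      unfolding Suc gauss_term_def P' qfac_Suc[of q A] qfac_Suc[of q q] qfac_Suc_shift[of q B] E_def u_def[symmetric]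
      by simp
    have g2: "gauss_term d A (B * q) (A * B * d * q) n = E * d * (1 - A * u) / (1 - q * u) * (1 - B * q * u)"
      unfolding Suc gauss_term_def qfac_Suc[of q A] qfac_Suc[of q q] qfac_Suc[of q "B * q"] E_def u_def[symmetric]
      by simp
    have g3: "gauss_term d A (B * q) (A * B * d * q) m = E * (1 - A * B * d * q * u)"
      unfolding gauss_term_def E_def using P by (simp add: u_def)
    \<comment> \<open>Absorbing the only denominator leaves a polynomial identity: once the
      subtracted terms are moved across, both sides equal
      \<open>X * (1 - B * q * u) * (1 - A * B * d * q * u)\<close>.\<close>
    define X where "X = E * d * (1 - A * u) / (1 - q * u)"
    have X: "E * d * (1 - A * u) = X * (1 - q * u)"
      using nz by (simp add: X_def)
    have "T (Suc n) - T n = B * d * (1 - A * (q * u)) * (X * (1 - B * q * u))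
       - B * (E * d * (1 - A * u)) * (1 - A * B * d * q * u)"
      unfolding X_def T_def g2[symmetric] by (simp add: Suc u_def g3)
    moreover have "X * (1 - B) * (1 - A * B * d * q * u) - (1 - d * B) * (X * (1 - B * q * u)) = \<dots>"
      unfolding X by (simp add: algebra_simps)
    ultimately show ?thesis
      unfolding g1 g2 X_def[symmetric] by simp
  qed
  have "(\<lambda>m. B * d * (1 - A * q ^ m) * gauss_term d A (B * q) (A * B * d * q) m) \<longlonglongrightarrow> B * d * (1 - 0) * 0"
    by (intro tendsto_intros geometric_tendsto_0 summable_LIMSEQ_zero summable_gauss_term assms)
  then have "T \<longlonglongrightarrow> 0"
    by (intro LIMSEQ_offset[where k = 1 and f = T]) (simp add: T_def)
  from telescope_sums[OF this]
  have "(\<lambda>n. gauss_term d A B (A * B * d) n - (1 - d * B) * gauss_term d A (B * q) (A * B * d * q) n) sums 0"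
    by (simp add: step T_def)
  moreover have "(\<lambda>n. gauss_term d A B (A * B * d) n - (1 - d * B) * gauss_term d A (B * q) (A * B * d * q) n) sums
     ((\<Sum>n. gauss_term d A B (A * B * d) n) - (1 - d * B) * (\<Sum>n. gauss_term d A (B * q) (A * B * d * q) n))"
    by (intro sums_diff sums_mult summable_sums summable_gauss_term assms)
  ultimately show ?thesis
    by (auto dest: sums_unique2)
qed

text \<open>After \<open>m\<close> steps the prefactor is \<open>qfac q (d * B) m\<close>; letting
  \<open>m\<close> tend to infinity sends it to the infinite product and the shifted parameters to
  0.\<close>

lemma gauss_factor:
  assumes "norm d < 1"
  shows "(\<Sum>n. gauss_term d A B (A * B * d) n) = qpoch_inf q (d * B) * (\<Sum>n. gauss_term d A 0 0 n)"
proof -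
  have "(\<Sum>n. gauss_term d A B (A * B * d) n) =
      qfac q (d * B) m * (\<Sum>n. gauss_term d A (B * q ^ m) (A * B * d * q ^ m) n)" for m
  proof (induction m)
    case (Suc m)
    have "(\<Sum>n. gauss_term d A (B * q ^ m) (A * B * d * q ^ m) n) =
       (1 - d * B * q ^ m) * (\<Sum>n. gauss_term d A (B * q ^ Suc m) (A * B * d * q ^ Suc m) n)"
      using gauss_step[OF assms, of A "B * q ^ m"] by (simp add: mult_ac)
    with Suc show ?case
      by (simp add: qfac_Suc)
  qed simp
  then have "(\<lambda>m. \<Sum>n. gauss_term d A B (A * B * d) n) \<longlonglongrightarrow> qpoch_inf q (d * B) * (\<Sum>n. gauss_term d A 0 0 n)"
    using tendsto_mult[OF qfac_tendsto[of "d * B"] suminf_gauss_term_tendsto[OF assms, of A B "A * B * d"]]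
    by simp
  then show ?thesis
    by (simp add: LIMSEQ_const_iff)
qed

lemma gauss_term_commute: "gauss_term d A B X = gauss_term d B A X"
  by (simp add: gauss_term_def fun_eq_iff)

lemma q_gauss:
  assumes "norm d < 1"
  shows "gauss_term d A B (A * B * d) sums (qpoch_inf q (d * A) * qpoch_inf q (d * B) / qpoch_inf q d)"
proof -
  \<comment> \<open>A first parameter 0 makes the absorbed product \<open>A * B * d\<close> vanish,
    so by symmetry the factor in \<open>A\<close> can be split off too.\<close>
  have A0: "(\<Sum>n. gauss_term d A 0 0 n) = qpoch_inf q (d * A) * (\<Sum>n. gauss_term d 0 0 0 n)" for A
    using gauss_factor[OF assms, of 0 A] by (simp add: gauss_term_commute[of d A])
  have "(\<Sum>n. gauss_term d 1 0 0 n) = (\<Sum>n\<in>{0}. gauss_term d 1 0 0 n)"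
    by (rule suminf_finite) (auto simp: gauss_term_def gr0_conv_Suc)
  then have "qpoch_inf q d * (\<Sum>n. gauss_term d 0 0 0 n) = 1"
    using A0[of 1] by (simp add: gauss_term_def)
  \<comment> \<open>The preceding equation itself forces \<open>qpoch_inf q d\<close> to be
    nonzero.\<close>
  then have "(\<Sum>n. gauss_term d 0 0 0 n) = 1 / qpoch_inf q d"
    by (metis mult_zero_left nonzero_mult_div_cancel_left zero_neq_one)
  with gauss_factor[OF assms, of A B] A0[of A] summable_sums[OF summable_gauss_term[OF assms, of A B "A * B * d"]]
  show ?thesis
    by (simp add: mult_ac)
qed

lemma q_binomial:
  assumes "norm d < 1"
  shows "(\<lambda>n. qfac q A n / qfac q q n * d ^ n) sums (qpoch_inf q (d * A) / qpoch_inf q d)"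
  using q_gauss[OF assms, of A 0] by (simp add: gauss_term_def[abs_def])


section \<open>Telescoping the two halves of the bilateral series\<close>

text \<open>\<open>R m - z * R (Suc m)\<close> produces the factor \<open>1 - z * q ^ n\<close>,
  which cancels the denominator in \<open>c n\<close> and leaves a q-binomial series at
  \<open>x * q ^ m\<close>. Weighting by \<open>z ^ m\<close> makes these differences
  telescope.\<close>

lemma telescoped_nonneg_series:
  assumes "norm x < 1" "norm z < 1"
  shows "(\<lambda>n. qpoch_inf q (d * x * q ^ n) / qpoch_inf q (x * q ^ n) * z ^ n) sums
    (\<Sum>n. qfac q d n / qfac q q n / (1 - z * q ^ n) * x ^ n)"
    and "summable (\<lambda>n. qfac q d n / qfac q q n / (1 - z * q ^ n) * x ^ n)"
proof -
  define c where "c n = qfac q d n / qfac q q n / (1 - z * q ^ n)" for n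
  define R where "R m = (\<Sum>n. c n * (x * q ^ m) ^ n)" for m
  have z1: "1 - z * q ^ n \<noteq> 0" for n
    using geometric_neq_1[OF q assms(2), of n] by auto
  have "Bseq (\<lambda>n. 1 / (1 - z * q ^ n))"
    by (rule convergent_imp_Bseq, rule convergentI, rule tendsto_divide[OF tendsto_const
          tendsto_diff[OF tendsto_const geometric_tendsto_0]]) simp
  from Bseq_mult[OF Bseq_qfac_quotient[of q d] this] have c: "Bseq c"
    using geometric_neq_1[OF q q] by (simp add: c_def[abs_def])
  have sm: "summable (\<lambda>n. c n * (x * q ^ m) ^ n)" for m
    by (intro summable_norm_cancel[OF summable_norm_Bseq_times_power] c norm_geometric_less_1 q assms)
  from sm[of 0] show "summable (\<lambda>n. qfac q d n / qfac q q n / (1 - z * q ^ n) * x ^ n)"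
    by (simp add: c_def)
  \<comment> \<open>A bound uniform in \<open>m\<close> makes the telescoping remainder
    \<open>R m * z ^ m\<close> tend to 0.\<close>
  have "norm (R m) \<le> (\<Sum>n. norm (c n * x ^ n))" for m
    unfolding R_def
  proof (rule norm_suminf_le)
    show "summable (\<lambda>n. norm (c n * x ^ n))"
      by (intro summable_norm_Bseq_times_power c assms)
    show "norm (c n * (x * q ^ m) ^ n) \<le> norm (c n * x ^ n)" for n
      unfolding norm_mult[of "c n"] norm_power
      by (intro mult_left_mono power_mono norm_geometric_le q) auto
  qed
  then have "Bseq R"
    by (rule BseqI')
  have step: "R m - z * R (Suc m) = qpoch_inf q (d * x * q ^ m) / qpoch_inf q (x * q ^ m)" for m
  proof -
    have "(\<lambda>n. c n * (x * q ^ m) ^ n - z * (c n * (x * q ^ Suc m) ^ n)) sums (R m - z * R (Suc m))"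
      unfolding R_def by (intro sums_diff sums_mult summable_sums sm)
    moreover have "c n * (x * q ^ m) ^ n - z * (c n * (x * q ^ Suc m) ^ n) =
        qfac q d n / qfac q q n * (x * q ^ m) ^ n" for n
    proof -
      have "(x * q ^ Suc m) ^ n = (x * q ^ m) ^ n * q ^ n"
        by (simp add: power_mult_distrib mult_ac)
      then have "c n * (x * q ^ m) ^ n - z * (c n * (x * q ^ Suc m) ^ n) =
          c n * (1 - z * q ^ n) * (x * q ^ m) ^ n"
        by (simp add: algebra_simps)
      with z1[of n] show ?thesis
        by (simp add: c_def)
    qed
    ultimately show ?thesis
      using sums_unique2[OF _ q_binomial[of "x * q ^ m" d]] norm_geometric_less_1[OF q assms(1), of m]
      by (simp add: mult_ac)
  qed
  have "(\<lambda>m. R m * z ^ m) \<longlonglongrightarrow> 0"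
    by (rule Bseq_times_power_tendsto_0) fact+
  from telescope_sums'[OF this]
  have "(\<lambda>m. R m * z ^ m - R (Suc m) * z ^ Suc m) sums R 0"
    by simp
  also have "(\<lambda>m. R m * z ^ m - R (Suc m) * z ^ Suc m) = (\<lambda>m. (R m - z * R (Suc m)) * z ^ m)"
    by (simp add: algebra_simps)
  finally show "(\<lambda>n. qpoch_inf q (d * x * q ^ n) / qpoch_inf q (x * q ^ n) * z ^ n) sums
    (\<Sum>n. qfac q d n / qfac q q n / (1 - z * q ^ n) * x ^ n)"
    unfolding step by (simp add: R_def c_def)
qed

lemma telescoped_nonpos_series:
  assumes "norm d < 1" "norm Z < 1" "d \<noteq> 0"
  shows "(\<lambda>n. qfac q B n * qpoch_inf q (d * B * q ^ n) * Z ^ n) sums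
    (qpoch_inf q d / qpoch_inf q Z * (\<Sum>n. gauss_term d (q * Z / d) B (B * Z) n))"
proof -
  \<comment> \<open>This choice gives \<open>A * b * d = b * q * Z\<close>, the absorbed product of
    the shifted series, and \<open>d * A = q * Z\<close>, so that
    \<open>(1 - Z) * qpoch_inf q (d * A)\<close> is \<open>qpoch_inf q Z\<close>.\<close>
  define A where "A = q * Z / d"
  define H where "H m = qpoch_inf q d / qpoch_inf q Z *
    (\<Sum>n. gauss_term d A (B * q ^ m) (B * Z * q ^ m) n)" for m
  have nz: "qpoch_inf q d \<noteq> 0" "qpoch_inf q Z \<noteq> 0" "qpoch_inf q (q * Z) \<noteq> 0" "1 - Z \<noteq> 0"
  proof -
    show "qpoch_inf q d \<noteq> 0" "qpoch_inf q Z \<noteq> 0"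
      by (intro qpoch_inf_nonzero geometric_neq_1 q assms)+
    then show "qpoch_inf q (q * Z) \<noteq> 0" "1 - Z \<noteq> 0"
      using qpoch_inf_step[of Z] by (auto simp: mult_ac)
  qed
  \<comment> \<open>The two terms combine because
    \<open>(1 - b * Z * q ^ n) - Z * (1 - b * q ^ n) = 1 - Z\<close>, independently of
    \<open>n\<close>.\<close>
  have diff: "gauss_term d A b (b * Z) n - (1 - b) * Z * gauss_term d A (b * q) (b * q * Z) n =
      (1 - Z) * gauss_term d A b (A * b * d) n" for b n
  proof -
    define Q where "Q = qpoch_inf q (b * q * Z * q ^ n)"
    define t where "t = qfac q A n / qfac q q n * d ^ n"
    have 1: "qpoch_inf q (b * Z * q ^ n) = (1 - b * Z * q ^ n) * Q"
      using qpoch_inf_step[of "b * Z * q ^ n"] by (simp add: Q_def mult_ac)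
    have 2: "A * b * d = b * q * Z"
      using assms by (simp add: A_def)
    have 3: "(1 - b) * qfac q (b * q) n = qfac q b n * (1 - b * q ^ n)"
      by (metis qfac_Suc qfac_Suc_shift)
    have "gauss_term d A b (b * Z) n - (1 - b) * Z * gauss_term d A (b * q) (b * q * Z) n =
       t * qfac q b n * ((1 - b * Z * q ^ n) * Q) - Z * t * Q * ((1 - b) * qfac q (b * q) n)"
      unfolding gauss_term_def 1 Q_def[symmetric] t_def by (simp add: mult_ac)
    also have "\<dots> = (1 - Z) * (t * qfac q b n * Q)"
      unfolding 3 by (simp add: algebra_simps)
    finally show ?thesis
      unfolding 2 by (simp add: gauss_term_def Q_def t_def)
  qed
  have step: "H m - (1 - B * q ^ m) * Z * H (Suc m) = qpoch_inf q (d * B * q ^ m)" for m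
  proof -
    define b where "b = B * q ^ m"
    have "(\<lambda>n. gauss_term d A b (b * Z) n - (1 - b) * Z * gauss_term d A (b * q) (b * q * Z) n) sums
      ((\<Sum>n. gauss_term d A b (b * Z) n) - (1 - b) * Z * (\<Sum>n. gauss_term d A (b * q) (b * q * Z) n))"
      by (intro sums_diff sums_mult summable_sums summable_gauss_term assms)
    moreover have "(\<lambda>n. gauss_term d A b (b * Z) n - (1 - b) * Z * gauss_term d A (b * q) (b * q * Z) n) sums
      ((1 - Z) * (qpoch_inf q (d * A) * qpoch_inf q (d * b) / qpoch_inf q d))"
      unfolding diff by (intro sums_mult q_gauss assms)
    ultimately have eq: "(\<Sum>n. gauss_term d A b (b * Z) n) - (1 - b) * Z * (\<Sum>n. gauss_term d A (b * q) (b * q * Z) n)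
      = (1 - Z) * (qpoch_inf q (d * A) * qpoch_inf q (d * b) / qpoch_inf q d)"
      by (rule sums_unique2)
    have "H m - (1 - b) * Z * H (Suc m) = qpoch_inf q d / qpoch_inf q Z *
      ((\<Sum>n. gauss_term d A b (b * Z) n) - (1 - b) * Z * (\<Sum>n. gauss_term d A (b * q) (b * q * Z) n))"
    proof -
      have "b * Z = B * Z * q ^ m" "b * q = B * q ^ Suc m" "b * q * Z = B * Z * q ^ Suc m"
        by (simp_all add: b_def)
      then show ?thesis
        unfolding H_def b_def[symmetric] by (simp only: right_diff_distrib mult_ac)
    qed
    also have "\<dots> = qpoch_inf q (d * b)"
    proof -
      have "d * A = q * Z"
        using assms by (simp add: A_def)
      then show ?thesis
        unfolding eq using nz qpoch_inf_step[of Z] by (simp add: mult_ac)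
    qed
    finally show ?thesis
      by (simp add: b_def mult_ac)
  qed
  \<comment> \<open>The weight \<open>qfac q B m * Z ^ m\<close> accounts for the coefficient
    \<open>(1 - B * q ^ m) * Z\<close> in \<open>step\<close>; boundedness removes the
    remainder.\<close>
  have "Bseq (\<lambda>m. qfac q B m * H m)"
    unfolding H_def
    by (intro Bseq_mult Bseq_qfac Bseq_suminf_gauss_term assms convergent_imp_Bseq convergent_const)
  from telescope_sums'[OF Bseq_times_power_tendsto_0[OF this assms(2)]]
  have "(\<lambda>m. qfac q B m * H m * Z ^ m - qfac q B (Suc m) * H (Suc m) * Z ^ Suc m) sums H 0"
    by simp
  also have "(\<lambda>m. qfac q B m * H m * Z ^ m - qfac q B (Suc m) * H (Suc m) * Z ^ Suc m) =
      (\<lambda>m. qfac q B m * (H m - (1 - B * q ^ m) * Z * H (Suc m)) * Z ^ m)"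
    by (simp add: qfac_Suc algebra_simps)
  finally show ?thesis
    unfolding step by (simp add: H_def A_def)
qed

section \<open>The one-sided transformations in quotient form\<close>

lemma qpoch_inf_divide_qfac:
  assumes "\<And>k. x * q ^ k \<noteq> 1"
  shows "qpoch_inf q x / qfac q x n = qpoch_inf q (x * q ^ n)"
  using qpoch_inf_eq_qfac[of x n] qfac_nonzero[OF assms, of n] by simp

lemma heine_nonneg_half:
  assumes "norm a < 1" "norm b < 1" "norm z < 1" "a \<noteq> 0"
  defines "t \<equiv> \<lambda>n. qfac q (b / a) n * qfac q z n / (qfac q q n * qfac q (q * z) n) * a ^ n"
  shows "summable t"
    and "(\<lambda>n. qfac q a n / qfac q b n * z ^ n) sums
      (qpoch_inf q a * qpoch_inf q (q * z) / (qpoch_inf q b * qpoch_inf q z) * suminf t)"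
proof -
  have nza: "qpoch_inf q (a * q ^ n) \<noteq> 0" for n
    by (intro qpoch_inf_nonzero geometric_neq_1 norm_geometric_less_1 q assms)
  have nzb: "qpoch_inf q (b * q ^ n) \<noteq> 0" for n
    by (intro qpoch_inf_nonzero geometric_neq_1 norm_geometric_less_1 q assms)
  have z1: "1 - z * q ^ n \<noteq> 0" for n
    using geometric_neq_1[OF q assms(3), of n] by auto
  have nzz: "qpoch_inf q z \<noteq> 0"
    by (intro qpoch_inf_nonzero geometric_neq_1 q assms)
  \<comment> \<open>\<open>qfac q z n / qfac q (q * z) n\<close> collapses to
    \<open>(1 - z) / (1 - z * q ^ n)\<close>, the denominator in the telescoped series.\<close>
  have t: "t = (\<lambda>n. (1 - z) * (qfac q (b / a) n / qfac q q n / (1 - z * q ^ n) * a ^ n))"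
  proof
    fix n
    have "norm (q * z) < 1"
      using norm_geometric_less_1[OF q assms(3), of 1] by (simp add: mult_ac)
    then have "qfac q (q * z) n \<noteq> 0"
      by (intro qfac_nonzero geometric_neq_1 q)
    moreover have "(1 - z) * qfac q (q * z) n = qfac q z n * (1 - z * q ^ n)"
      by (metis qfac_Suc qfac_Suc_shift mult.commute)
    ultimately have "qfac q z n / qfac q (q * z) n = (1 - z) / (1 - z * q ^ n)"
      using z1[of n] by (simp add: divide_simps mult_ac)
    moreover have "t n = qfac q (b / a) n / qfac q q n * (qfac q z n / qfac q (q * z) n) * a ^ n"
      by (simp add: t_def)
    ultimately show "t n = (1 - z) * (qfac q (b / a) n / qfac q q n / (1 - z * q ^ n) * a ^ n)"
      by (simp add: mult_ac)
  qed
  note heine = telescoped_nonneg_series[OF assms(1,3), of "b / a"]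
  show "summable t"
    unfolding t by (intro summable_mult heine(2))
  have "suminf t = (1 - z) * (\<Sum>n. qfac q (b / a) n / qfac q q n / (1 - z * q ^ n) * a ^ n)"
    unfolding t by (intro suminf_mult heine(2))
  then have val: "qpoch_inf q a * qpoch_inf q (q * z) / (qpoch_inf q b * qpoch_inf q z) * suminf t =
      qpoch_inf q a / qpoch_inf q b * (\<Sum>n. qfac q (b / a) n / qfac q q n / (1 - z * q ^ n) * a ^ n)"
    using qpoch_inf_step[of z] nzz by (simp add: mult_ac)
  have "qfac q a n / qfac q b n * z ^ n = qpoch_inf q a / qpoch_inf q b *
      (qpoch_inf q (b / a * a * q ^ n) / qpoch_inf q (a * q ^ n) * z ^ n)" for n
  proof -
    have "qfac q a n = qpoch_inf q a / qpoch_inf q (a * q ^ n)"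
      using qpoch_inf_eq_qfac[of a n] nza[of n] by simp
    moreover have "qfac q b n = qpoch_inf q b / qpoch_inf q (b * q ^ n)"
      using qpoch_inf_eq_qfac[of b n] nzb[of n] by simp
    ultimately show ?thesis
      using assms(4) by simp (simp add: mult_ac)
  qed
  then show "(\<lambda>n. qfac q a n / qfac q b n * z ^ n) sums
      (qpoch_inf q a * qpoch_inf q (q * z) / (qpoch_inf q b * qpoch_inf q z) * suminf t)"
    unfolding val using sums_mult[OF heine(1), of "qpoch_inf q a / qpoch_inf q b"] by simp
qed

text \<open>Dividing by the nonzero products at \<open>d * B\<close> and \<open>B * Z\<close>
  restores the finite denominators that the telescoped identity had absorbed.\<close>

lemma heine_nonpos_half:
  assumes "norm d < 1" "norm Z < 1" "d \<noteq> 0"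
    and dB: "\<And>k. d * B * q ^ k \<noteq> 1" and BZ: "\<And>k. B * Z * q ^ k \<noteq> 1"
  defines "t \<equiv> \<lambda>n. qfac q (q * Z / d) n * qfac q B n / (qfac q q n * qfac q (B * Z) n) * d ^ n"
  shows "summable t"
    and "(\<lambda>n. qfac q B n / qfac q (d * B) n * Z ^ n) sums
      (qpoch_inf q d * qpoch_inf q (B * Z) / (qpoch_inf q (d * B) * qpoch_inf q Z) * suminf t)"
proof -
  have nzB: "qpoch_inf q (B * Z) \<noteq> 0" "qpoch_inf q (d * B) \<noteq> 0"
    by (intro qpoch_inf_nonzero assms)+
  have t: "t n = 1 / qpoch_inf q (B * Z) * gauss_term d (q * Z / d) B (B * Z) n" for n
    unfolding gauss_term_def t_def qpoch_inf_divide_qfac[OF BZ, symmetric] using nzB by (simp add: mult_ac)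
  have sm: "summable (gauss_term d (q * Z / d) B (B * Z))"
    by (intro summable_gauss_term assms)
  show "summable t"
    unfolding t using sm by (intro summable_mult)
  have "suminf t = 1 / qpoch_inf q (B * Z) * (\<Sum>n. gauss_term d (q * Z / d) B (B * Z) n)"
    unfolding t by (rule suminf_mult[OF sm])
  then have val: "qpoch_inf q d * qpoch_inf q (B * Z) / (qpoch_inf q (d * B) * qpoch_inf q Z) * suminf t
      = 1 / qpoch_inf q (d * B) * (qpoch_inf q d / qpoch_inf q Z * (\<Sum>n. gauss_term d (q * Z / d) B (B * Z) n))"
    using nzB by simp
  have "qfac q B n / qfac q (d * B) n * Z ^ n =
      1 / qpoch_inf q (d * B) * (qfac q B n * qpoch_inf q (d * B * q ^ n) * Z ^ n)" for n
    unfolding qpoch_inf_divide_qfac[OF dB, symmetric] using nzB by simp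
  then show "(\<lambda>n. qfac q B n / qfac q (d * B) n * Z ^ n) sums
      (qpoch_inf q d * qpoch_inf q (B * Z) / (qpoch_inf q (d * B) * qpoch_inf q Z) * suminf t)"
    unfolding val using sums_mult[OF telescoped_nonpos_series[OF assms(1-3), of B], of "1 / qpoch_inf q (d * B)"]
    by simp
qed

end

section \<open>Assembly of the bilateral series\<close>

lemma qpoch_int_eq_qfac: "norm q < 1 \<Longrightarrow> qpoch q x (int n) = qfac q x n"
  by (simp add: qpoch_nonneg qfac_def)

text \<open>Each factor reverses as \<open>1 - x / q ^ k = - (x / q ^ k) * (1 - q ^ k / x)\<close>;
  signs and powers of \<open>q\<close> cancel in the quotient, leaving \<open>b / a\<close>. At a
  pole of the denominator both sides are 0.\<close>

lemma qpoch_neg_quotient: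
  assumes "norm q < 1" "q \<noteq> 0" "a \<noteq> 0" "b \<noteq> 0" "\<And>k. q / a * q ^ k \<noteq> 1"
  shows "qpoch q a (- int n) / qpoch q b (- int n) = qfac q (q / b) n / qfac q (q / a) n * (b / a) ^ n"
proof -
  have "(\<Prod>k=1..n. 1 - b / q ^ k) / (\<Prod>k=1..n. 1 - a / q ^ k) =
      qfac q (q / b) n / qfac q (q / a) n * (b / a) ^ n"
  proof (induction n)
    case (Suc n)
    have "1 - x / q ^ Suc n = - (x / q ^ Suc n) * (1 - q / x * q ^ n)" if "x \<noteq> 0" for x
      using that assms(2) by (simp add: field_simps)
    then have ratio: "(1 - b / q ^ Suc n) / (1 - a / q ^ Suc n) =
        (1 - q / b * q ^ n) / (1 - q / a * q ^ n) * (b / a)"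
      using assms(2-4) by (simp add: mult_ac del: power_Suc)
    have "(\<Prod>k=1..Suc n. 1 - b / q ^ k) / (\<Prod>k=1..Suc n. 1 - a / q ^ k) =
        (\<Prod>k=1..n. 1 - b / q ^ k) / (\<Prod>k=1..n. 1 - a / q ^ k) *
        ((1 - b / q ^ Suc n) / (1 - a / q ^ Suc n))"
      by (simp only: prod.nat_ivl_Suc' times_divide_times_eq mult.commute le_add2 plus_1_eq_Suc)
    also have "\<dots> = qfac q (q / b) (Suc n) / qfac q (q / a) (Suc n) * (b / a) ^ Suc n"
      unfolding Suc.IH ratio qfac_Suc by (simp only: times_divide_times_eq power_Suc power_divide mult_ac)
    finally show ?case .
  qed simp
  then show ?thesis
    by (simp add: qpoch_neg assms)
qed

text \<open>Both one-sided sums contain index 0, so \<open>f 0\<close> is removed once; this is the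
  source of the \<open>- 1\<close> in the theorem.\<close>

lemma has_sum_int_halves:
  fixes f :: "int \<Rightarrow> 'a :: banach"
  assumes "summable (\<lambda>n. norm (f (int n)))" "(\<lambda>n. f (int n)) sums S"
    and "summable (\<lambda>n. norm (f (- int n)))" "(\<lambda>n. f (- int n)) sums T"
  shows "(f has_sum (S + (T - f 0))) UNIV"
proof -
  have "((\<lambda>n. f (int n)) has_sum S) UNIV"
    by (intro norm_summable_imp_has_sum assms)
  then have 1: "(f has_sum S) (range int)"
    by (subst has_sum_reindex) (auto simp: o_def)
  have "((\<lambda>n. f (- int (Suc n))) has_sum (T - f 0)) UNIV"
  proof (rule norm_summable_imp_has_sum)
    show "summable (\<lambda>n. norm (f (- int (Suc n))))"
      using assms(3) by (subst summable_Suc_iff)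
    show "(\<lambda>n. f (- int (Suc n))) sums (T - f 0)"
      using assms(4) by (subst sums_Suc_iff) simp
  qed
  then have 2: "(f has_sum (T - f 0)) (range (\<lambda>n. - int (Suc n)))"
    by (subst has_sum_reindex) (auto simp: o_def inj_def)
  have "range int \<union> range (\<lambda>n. - int (Suc n)) = UNIV"
  proof (intro equalityI subsetI)
    show "x \<in> range int \<union> range (\<lambda>n. - int (Suc n))" for x
      by (cases x rule: int_cases) blast+
  qed simp
  moreover have "range int \<inter> range (\<lambda>n. - int (Suc n)) = {}"
    by auto
  ultimately show ?thesis
    using has_sum_Un_disjoint[OF 1 2] by simp
qed

theorem theorem2p2:
  fixes q a b z :: complex
  assumes "norm q < 1"
    and "norm (b / a) < norm z" and "norm z < 1"
    and "norm a < 1"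
    and "q \<noteq> 0" and "a \<noteq> 0" and "b \<noteq> 0"
    and "\<forall>k::nat. k \<ge> 1 \<longrightarrow> a \<noteq> q ^ k"
    and "\<forall>k::nat. k \<ge> 1 \<longrightarrow> a * z \<noteq> q ^ k"
  shows "(\<lambda>n::int. qpoch q a n / qpoch q b n * z powi n) summable_on UNIV
    \<and> summable (\<lambda>n::nat. qpoch q (b / a) (int n) * qpoch q z (int n)
          / (qpoch q q (int n) * qpoch q (q * z) (int n)) * a ^ n)
    \<and> summable (\<lambda>n::nat. qpoch q (q / z) (int n) * qpoch q (q / b) (int n)
          / (qpoch q q (int n) * qpoch q (q / (a * z)) (int n)) * (b / a) ^ n)
    \<and> (\<Sum>\<^sub>\<infinity>n::int. qpoch q a n / qpoch q b n * z powi n) =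
      - 1
      + qpoch_inf q a * qpoch_inf q (q * z) / (qpoch_inf q b * qpoch_inf q z)
        * (\<Sum>n::nat. qpoch q (b / a) (int n) * qpoch q z (int n)
            / (qpoch q q (int n) * qpoch q (q * z) (int n)) * a ^ n)
      + qpoch_inf q (b / a) * qpoch_inf q (q / (a * z))
          / (qpoch_inf q (q / a) * qpoch_inf q (b / (a * z)))
        * (\<Sum>n::nat. qpoch q (q / z) (int n) * qpoch q (q / b) (int n)
            / (qpoch q q (int n) * qpoch q (q / (a * z)) (int n)) * (b / a) ^ n)"
proof -
  note q = assms(1)
  \<comment> \<open>\<open>Z\<close> is the geometric ratio of the terms with negative index; the
    condition \<open>norm (b / a) < norm z\<close> is what gives \<open>norm Z < 1\<close>.\<close>
  define Z where "Z = b / (a * z)"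
  have z0: "z \<noteq> 0"
    using assms(2) by auto
  have d: "norm (b / a) < 1" "b / a \<noteq> 0"
    using assms by auto
  have Z: "norm Z < 1"
  proof -
    have "norm Z = norm (b / a) / norm z"
      by (simp add: Z_def norm_divide norm_mult)
    with assms(2) z0 show ?thesis
      by (simp del: norm_divide)
  qed
  have b: "norm b < 1"
  proof -
    have "norm b = norm (b / a) * norm a"
      using assms(6) by (simp add: norm_divide)
    also have "\<dots> \<le> norm (b / a)"
      using assms(4) by (intro mult_left_le) auto
    also note d(1)
    finally show ?thesis .
  qed
  \<comment> \<open>Equality would mean \<open>a = q ^ Suc k\<close>, which explains why the
    excluded exponents start at 1.\<close>
  have qa: "q / a * q ^ k \<noteq> 1" for k
    using assms(6) assms(8)[rule_format, of "Suc k"] by auto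
  have qaz: "q / (a * z) * q ^ k \<noteq> 1" for k
    using assms(6) assms(9)[rule_format, of "Suc k"] z0 by auto
  \<comment> \<open>With \<open>d = b / a\<close> and \<open>B = q / b\<close>, these turn the
    parameters of \<open>heine_nonpos_half\<close> into those of the theorem.\<close>
  have eqs: "b / a * (q / b) = q / a" "q / b * Z = q / (a * z)" "q * Z / (b / a) = q / z"
    using assms(6,7) by (auto simp: Z_def)
  have dB: "b / a * (q / b) * q ^ k \<noteq> 1" for k
    unfolding eqs by (rule qa)
  have BZ: "q / b * Z * q ^ k \<noteq> 1" for k
    unfolding eqs by (rule qaz)
  note pos = heine_nonneg_half[OF q assms(4) b assms(3,6)]
  note neg = heine_nonpos_half[OF q d(1) Z d(2), of "q / b", OF dB BZ, unfolded eqs]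
  define f where "f n = qpoch q a n / qpoch q b n * z powi n" for n
  have f_pos: "f (int n) = qfac q a n / qfac q b n * z ^ n" for n
    by (simp add: f_def qpoch_int_eq_qfac[OF q])
  have f_neg: "f (- int n) = qfac q (q / b) n / qfac q (q / a) n * Z ^ n" for n
    unfolding f_def qpoch_neg_quotient[OF q assms(5-7) qa]
    by (simp add: Z_def power_int_minus power_divide power_mult_distrib divide_simps)
  have "summable (\<lambda>n. norm (f (int n)))"
    unfolding f_pos
    by (intro summable_norm_Bseq_times_power Bseq_qfac_quotient geometric_neq_1 q b assms)
  moreover have "summable (\<lambda>n. norm (f (- int n)))"
    unfolding f_neg by (intro summable_norm_Bseq_times_power Bseq_qfac_quotient q qa Z)
  ultimately have "(f has_sum (qpoch_inf q a * qpoch_inf q (q * z) / (qpoch_inf q b * qpoch_inf q z)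
        * (\<Sum>n. qfac q (b / a) n * qfac q z n / (qfac q q n * qfac q (q * z) n) * a ^ n)
      + (qpoch_inf q (b / a) * qpoch_inf q (q / (a * z)) / (qpoch_inf q (q / a) * qpoch_inf q Z)
        * (\<Sum>n. qfac q (q / z) n * qfac q (q / b) n / (qfac q q n * qfac q (q / (a * z)) n) * (b / a) ^ n)
      - f 0))) UNIV"
    using pos(2) neg(2) by (intro has_sum_int_halves) (simp_all only: f_pos f_neg)
  moreover have "f 0 = 1"
    using f_pos[of 0] by simp
  ultimately have "f summable_on UNIV \<and> (\<Sum>\<^sub>\<infinity>n. f n) = - 1
      + qpoch_inf q a * qpoch_inf q (q * z) / (qpoch_inf q b * qpoch_inf q z)
        * (\<Sum>n. qfac q (b / a) n * qfac q z n / (qfac q q n * qfac q (q * z) n) * a ^ n)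
      + qpoch_inf q (b / a) * qpoch_inf q (q / (a * z)) / (qpoch_inf q (q / a) * qpoch_inf q Z)
        * (\<Sum>n. qfac q (q / z) n * qfac q (q / b) n / (qfac q q n * qfac q (q / (a * z)) n) * (b / a) ^ n)"
    by (auto simp: summable_on_def dest: infsumI)
  with pos(1) neg(1) show ?thesis
    unfolding f_def Z_def qpoch_int_eq_qfac[OF q] by blast
qed

end
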